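(* Let $\mu$ be a probability measure on $\mathbb{R}$, and let $f:\mathbb{R}\to\mathbb{R}$ be bi-Lipschitz: there are $m,M>0$ such that for all $x,y\in\mathbb{R}$, $$m|x-y|\le|f(x)-f(y)|\le M|x-y|.$$ Let $\eta$ be the push-forward of $\mu$ by $f$. Then $\delta_{c}(\mu)=\delta_{c}(\eta)$.
   Context: For $t>0$, let $\nu_t$ be the centered Gaussian law on $\mathbb{R}$ with variance $t^2$. For a probability measure $\rho$ on $\mathbb{R}$, let $\rho_t=\rho*\nu_t$. Write $H(p(x)\,dx)=\int p\log p\,dx$, and define $$\delta_c(\rho)=1-\liminf_{t\to0}\frac{H(\rho_t)}{|\log t|}.$$ *)

theory Defs
  imports "HOL-Probability.Probability"
begin

definition gauss_smooth_density :: "real measure \<Rightarrow> real \<Rightarrow> real \<Rightarrow> real" where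
  "gauss_smooth_density \<rho> t x = (\<integral> y. normal_density 0 t (x - y) \<partial>\<rho>)"

text \<open>Differential entropy H(p dx) = integral of p log p dx (Lebesgue), as an extended real:
  positive part minus negative part (the positive part is finite for Gaussian-smoothed densities).\<close>
definition entropyH :: "(real \<Rightarrow> real) \<Rightarrow> ereal" where
  "entropyH p =
     enn2ereal (\<integral>\<^sup>+ x. ennreal (max 0 (p x * ln (p x))) \<partial>lborel)
   - enn2ereal (\<integral>\<^sup>+ x. ennreal (max 0 (- (p x * ln (p x)))) \<partial>lborel)"

definition delta_c :: "real measure \<Rightarrow> ereal" where
  "delta_c \<rho> = 1 - Liminf (at_right 0)
      (\<lambda>t. entropyH (gauss_smooth_density \<rho> t) / ereal \<bar>ln t\<bar>)"

end

theory Submission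
  imports Defs
begin

text \<open>Write \<open>p\<^sub>t\<close> for the Gaussian mixture density and \<open>D\<^sub>s x = \<integral> exp (- |x - y| / s) d\<rho> y\<close>. The logarithm
  of \<open>D\<^sub>s\<close> is Lipschitz with constant \<open>1 / s\<close>, and \<open>t p\<^sub>t \<le> D\<^sub>t\<close>. Hence \<open>- \<integral> ln D\<^sub>t d\<rho>\<close> is at most
  \<open>- \<integral> p\<^sub>t ln (t p\<^sub>t)\<close> up to a constant, while Gibbs' inequality against the density \<open>D\<^sub>s / (2 s)\<close> bounds
  the latter by \<open>- \<integral> ln D\<^sub>s d\<rho>\<close> plus a constant depending only on \<open>t / s\<close>. The Laplace integrals for
  \<open>\<mu>\<close> and \<open>\<eta>\<close> compare directly by the bi-Lipschitz bounds, after rescaling \<open>s\<close> by \<open>1 / m\<close> or \<open>M\<close>. So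
  the entropies of \<open>\<mu>\<^sub>t\<close> and \<open>\<eta>\<^sub>t\<close> differ by a bounded amount (and are infinite together), which
  disappears after dividing by \<open>|ln t|\<close>.\<close>

definition laplace_avg :: "real measure \<Rightarrow> real \<Rightarrow> real \<Rightarrow> real" where
  "laplace_avg \<rho> s x = (\<integral> y. exp (- \<bar>x - y\<bar> / s) \<partial>\<rho>)"

text \<open>For \<open>s > 0\<close> the average lies in (0, 1], so its negated logarithm is
  nonnegative and the truncation by \<open>ennreal\<close> loses nothing; the value may be
  infinite.\<close>

definition laplace_cost :: "real measure \<Rightarrow> real \<Rightarrow> ennreal" where
  "laplace_cost \<rho> s = (\<integral>\<^sup>+ x. ennreal (- ln (laplace_avg \<rho> s x)) \<partial>\<rho>)"

text \<open>The factor \<open>t\<close> inside the logarithm makes \<open>- ln (t * p\<^sub>t)\<close> nonnegative, so that no signed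
  integral of \<open>p\<^sub>t ln p\<^sub>t\<close> is needed.\<close>

definition gauss_cost :: "real measure \<Rightarrow> real \<Rightarrow> ennreal" where
  "gauss_cost \<rho> t = (\<integral>\<^sup>+ x. ennreal (gauss_smooth_density \<rho> t x) *
     ennreal (- ln (t * gauss_smooth_density \<rho> t x)) \<partial>lborel)"

section \<open>Gaussian and Laplace kernels: pointwise bounds and Lebesgue integrals\<close>

lemma ennreal_mult_plus:
  assumes "0 \<le> a" "0 \<le> b" "0 \<le> c"
  shows "ennreal (a * b + c) = ennreal a * ennreal b + ennreal c"
  using assms by (simp add: ennreal_mult)

text \<open>With \<open>v = x / t\<close>, the square of \<open>\<bar>v\<bar> - 1\<close> being
  nonnegative bounds the Gaussian exponent by 1/2 - |v|. The surplus factor exp(1/2) is at most 2,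
  hence at most the normalising sqrt(2 pi), so the constant is exactly 1.\<close>

lemma normal_density_le_laplace:
  fixes t x :: real
  assumes "t > 0"
  shows "t * normal_density 0 t x \<le> exp (- \<bar>x\<bar> / t)"
proof -
  define v where "v = x / t"
  have x: "x = t * v" using assms by (simp add: v_def)
  have "exp (1/2 :: real) \<le> 2" by (rule exp_half_le2)
  also have "2 \<le> sqrt (2 * pi)"
    using pi_ge_two by (intro real_le_rsqrt) simp
  finally have c: "exp (1/2 :: real) \<le> sqrt (2 * pi)" .
  have "0 \<le> (\<bar>v\<bar> - 1)\<^sup>2" by simp
  then have "- v\<^sup>2 / 2 \<le> 1/2 - \<bar>v\<bar>"
    by (simp add: power2_diff)
  then have "exp (- v\<^sup>2 / 2) \<le> exp (1/2) * exp (- \<bar>v\<bar>)"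
    by (simp flip: exp_add)
  also have "\<dots> \<le> sqrt (2 * pi) * exp (- \<bar>v\<bar>)"
    using c by (intro mult_right_mono) auto
  finally have "exp (- v\<^sup>2 / 2) / sqrt (2 * pi) \<le> exp (- \<bar>v\<bar>)"
    by (simp add: field_simps)
  moreover have "t * normal_density 0 t x = exp (- v\<^sup>2 / 2) / sqrt (2 * pi)"
    using assms unfolding normal_density_def x
    by (simp add: real_sqrt_mult power_mult_distrib)
  moreover have "\<bar>x\<bar> / t = \<bar>v\<bar>"
    using assms unfolding x by (simp add: abs_mult)
  ultimately show ?thesis by simp
qed

lemma nn_integral_lborel_shift:
  fixes f :: "real \<Rightarrow> ennreal"
  assumes "f \<in> borel_measurable borel"
  shows "(\<integral>\<^sup>+x. f (x - y) \<partial>lborel) = (\<integral>\<^sup>+x. f x \<partial>lborel)"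
  using nn_integral_real_affine[OF assms, of 1 "- y"] by simp

lemma nn_integral_normal_density_shift:
  assumes "t > 0"
  shows "(\<integral>\<^sup>+x. ennreal (normal_density 0 t (x - y)) \<partial>lborel) = 1"
proof -
  have "(\<integral>\<^sup>+x. ennreal (normal_density 0 t x) \<partial>lborel) = 1"
    using assms by (subst nn_integral_eq_integral) (auto simp: normal_density_nonneg)
  then show ?thesis
    by (subst nn_integral_lborel_shift) auto
qed

text \<open>The first absolute moment of the centered Gaussian with standard deviation
  \<open>t\<close> is t sqrt(2 / pi), and 2 / pi is at most 1.\<close>

lemma nn_integral_normal_density_abs_shift:
  assumes "t > 0" "s > 0"
  shows "(\<integral>\<^sup>+x. ennreal (normal_density 0 t (x - y)) * ennreal (\<bar>x - y\<bar> / s) \<partial>lborel) \<le> ennreal (t / s)"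
proof -
  have "has_bochner_integral lborel (\<lambda>x. normal_density 0 t x * \<bar>x\<bar>) (t * sqrt (2 / pi))"
    using normal_moment_abs_odd[OF assms(1), of 0 0] by simp
  then have hb: "has_bochner_integral lborel (\<lambda>x. normal_density 0 t x * \<bar>x\<bar> / s) (t * sqrt (2 / pi) / s)"
    by (rule has_bochner_integral_divide_zero)
  have "(\<integral>\<^sup>+x. ennreal (normal_density 0 t (x - y)) * ennreal (\<bar>x - y\<bar> / s) \<partial>lborel)
      = (\<integral>\<^sup>+x. ennreal (normal_density 0 t x) * ennreal (\<bar>x\<bar> / s) \<partial>lborel)"
    by (rule nn_integral_lborel_shift[of "\<lambda>x. ennreal (normal_density 0 t x) * ennreal (\<bar>x\<bar> / s)"]) measurable
  also have "\<dots> = (\<integral>\<^sup>+x. ennreal (normal_density 0 t x * \<bar>x\<bar> / s) \<partial>lborel)"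
    using assms by (intro nn_integral_cong) (simp add: normal_density_nonneg flip: ennreal_mult)
  also have "\<dots> = ennreal (t * sqrt (2 / pi) / s)"
    using hb assms
    by (subst nn_integral_eq_integral) (auto simp: has_bochner_integral_iff normal_density_nonneg)
  also have "\<dots> \<le> ennreal (t / s)"
  proof (rule ennreal_leI)
    have "sqrt (2 / pi) \<le> 1" using pi_ge_two by simp
    then show "t * sqrt (2 / pi) / s \<le> t / s"
      using assms by (simp add: divide_right_mono mult_left_le)
  qed
  finally show ?thesis .
qed

text \<open>This is the mean error of replacing a function with Lipschitz constant 1/s by its value
  \<open>c\<close> at the centre of the Gaussian. The value \<open>c\<close> may be
  infinite.\<close>

lemma nn_integral_normal_density_add:
  assumes "t > 0" "s > 0"
  shows "(\<integral>\<^sup>+x. ennreal (normal_density 0 t (x - y)) * (c + ennreal (\<bar>x - y\<bar> / s)) \<partial>lborel)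
    \<le> c + ennreal (t / s)"
proof -
  have "(\<integral>\<^sup>+x. ennreal (normal_density 0 t (x - y)) * (c + ennreal (\<bar>x - y\<bar> / s)) \<partial>lborel)
    = (\<integral>\<^sup>+x. ennreal (normal_density 0 t (x - y)) * c \<partial>lborel)
      + (\<integral>\<^sup>+x. ennreal (normal_density 0 t (x - y)) * ennreal (\<bar>x - y\<bar> / s) \<partial>lborel)"
    by (simp add: distrib_left nn_integral_add)
  also have "\<dots> \<le> c + ennreal (t / s)"
    using nn_integral_normal_density_abs_shift[OF assms]
    by (intro add_mono) (auto simp: nn_integral_multc nn_integral_normal_density_shift[OF assms(1)])
  finally show ?thesis .
qed

lemma nn_integral_laplace_le:
  assumes "s > 0"
  shows "(\<integral>\<^sup>+x. ennreal (exp (- \<bar>x - y\<bar> / s)) \<partial>lborel) \<le> ennreal (2 * s)"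
proof -
  let ?e = "exponential_density (1 / s)"
  have e1: "(\<integral>\<^sup>+x. ennreal (?e x) \<partial>lborel) = 1"
  proof -
    interpret prob_space "density lborel ?e"
      using assms by (intro prob_space_exponential_density) simp
    show ?thesis using emeasure_space_1 by (simp add: emeasure_density)
  qed
  have e2: "(\<integral>\<^sup>+x. ennreal (?e (- x)) \<partial>lborel) = 1"
    using nn_integral_real_affine[of "\<lambda>x. ennreal (?e x)" "-1" 0] e1 by simp
  have "(\<integral>\<^sup>+x. ennreal (exp (- \<bar>x - y\<bar> / s)) \<partial>lborel) = (\<integral>\<^sup>+x. ennreal (exp (- \<bar>x\<bar> / s)) \<partial>lborel)"
    by (rule nn_integral_lborel_shift[of "\<lambda>x. ennreal (exp (- \<bar>x\<bar> / s))"]) measurable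
  \<comment> \<open>The kernel is \<open>s\<close> times the sum of the exponential density of rate
    1/s and its reflection, except at 0, where both densities count and only the inequality
    remains.\<close>
  also have "\<dots> \<le> (\<integral>\<^sup>+x. ennreal s * (ennreal (?e x) + ennreal (?e (- x))) \<partial>lborel)"
    using assms
    by (intro nn_integral_mono)
       (auto simp: exponential_density_def simp flip: ennreal_plus ennreal_mult intro!: ennreal_leI)
  also have "\<dots> = ennreal (2 * s)"
    using assms
    by (simp add: nn_integral_cmult nn_integral_add e1 e2 ennreal_mult mult.commute)
  finally show ?thesis .
qed

section \<open>Smoothed averages of a probability law on the line\<close>

context real_distribution
begin

lemma integrable_laplace: "s > 0 \<Longrightarrow> integrable M (\<lambda>y. exp (- \<bar>x - y\<bar> / s))"
  by (rule integrable_const_bound[where B = 1]) auto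

lemma integrable_normal_density_diff:
  assumes "t > 0"
  shows "integrable M (\<lambda>y. normal_density 0 t (x - y))"
proof (rule integrable_const_bound[where B = "1 / t"])
  have "normal_density 0 t z \<le> 1 / t" for z
  proof -
    have "t * normal_density 0 t z \<le> exp (- \<bar>z\<bar> / t)"
      by (rule normal_density_le_laplace[OF assms])
    also have "\<dots> \<le> 1" using assms by simp
    finally show ?thesis using assms by (simp add: field_simps)
  qed
  then show "AE y in M. norm (normal_density 0 t (x - y)) \<le> 1 / t"
    by (simp add: normal_density_nonneg)
qed measurable

lemma measurable_laplace_avg [measurable]: "laplace_avg M s \<in> borel_measurable borel"
  unfolding laplace_avg_def by measurable

lemma measurable_gauss_smooth_density [measurable]:
  "gauss_smooth_density M t \<in> borel_measurable borel"
  unfolding gauss_smooth_density_def by measurable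

lemma laplace_avg_pos: assumes "s > 0" shows "0 < laplace_avg M s x"
  unfolding laplace_avg_def
  using integral_less_AE_space[of "\<lambda>_. 0" "\<lambda>y. exp (- \<bar>x - y\<bar> / s)"] integrable_laplace[OF assms]
  by (simp add: emeasure_space_1[simplified])

lemma gauss_smooth_density_pos: assumes "t > 0" shows "0 < gauss_smooth_density M t x"
  unfolding gauss_smooth_density_def
  using integral_less_AE_space[of "\<lambda>_. 0" "\<lambda>y. normal_density 0 t (x - y)"]
    integrable_normal_density_diff[OF assms]
  by (simp add: emeasure_space_1[simplified] normal_density_pos assms)

lemma laplace_avg_le_1: assumes "s > 0" shows "laplace_avg M s x \<le> 1"
proof -
  have "laplace_avg M s x \<le> (\<integral>y. 1 \<partial>M)"
    unfolding laplace_avg_def using assms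
    by (intro integral_mono integrable_laplace) auto
  then show ?thesis by (simp add: prob_space[simplified])
qed

text \<open>Besides comparing the two costs, this bound together with
  \<open>laplace_avg_le_1\<close> shows that \<open>- ln (t * gauss_smooth_density M t x)\<close> is
  nonnegative.\<close>

lemma gauss_smooth_density_le_laplace_avg:
  assumes "t > 0"
  shows "t * gauss_smooth_density M t x \<le> laplace_avg M t x"
proof -
  have "t * gauss_smooth_density M t x = (\<integral>y. t * normal_density 0 t (x - y) \<partial>M)"
    unfolding gauss_smooth_density_def by simp
  also have "\<dots> \<le> laplace_avg M t x"
    unfolding laplace_avg_def using assms
    by (intro integral_mono integrable_laplace normal_density_le_laplace
         integrable_mult_right integrable_normal_density_diff) auto
  finally show ?thesis .
qed

text \<open>The triangle inequality makes the kernel supermultiplicative: the product of its values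
  at (x, y) and (y, z) is at most its value at (x, z). Integrate over z and take logarithms.\<close>

lemma neg_ln_laplace_avg_le:
  assumes "s > 0"
  shows "- ln (laplace_avg M s x) \<le> - ln (laplace_avg M s y) + \<bar>x - y\<bar> / s"
proof -
  have "exp (- \<bar>x - y\<bar> / s) * laplace_avg M s y = (\<integral>z. exp (- \<bar>x - y\<bar> / s) * exp (- \<bar>y - z\<bar> / s) \<partial>M)"
    unfolding laplace_avg_def by simp
  also have "\<dots> \<le> laplace_avg M s x"
    unfolding laplace_avg_def
  proof (intro integral_mono integrable_laplace integrable_mult_right assms)
    fix z
    have "\<bar>x - z\<bar> \<le> \<bar>x - y\<bar> + \<bar>y - z\<bar>" by simp
    then show "exp (- \<bar>x - y\<bar> / s) * exp (- \<bar>y - z\<bar> / s) \<le> exp (- \<bar>x - z\<bar> / s)"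
      using assms by (simp add: divide_simps flip: exp_add)
  qed
  finally have "ln (exp (- \<bar>x - y\<bar> / s) * laplace_avg M s y) \<le> ln (laplace_avg M s x)"
    using laplace_avg_pos[OF assms] by (subst ln_le_cancel_iff) auto
  then show ?thesis
    using laplace_avg_pos[OF assms, of y] by (simp add: ln_mult)
qed

text \<open>Tonelli: integrating against the smoothed law means averaging over the centre
  \<open>y\<close>, then over the Gaussian around it. Since \<open>g\<close> takes values in
  \<open>ennreal\<close>, it may have infinite integral.\<close>

lemma nn_integral_gauss_smooth_density:
  assumes "t > 0" and [measurable]: "g \<in> borel_measurable borel"
  shows "(\<integral>\<^sup>+x. ennreal (gauss_smooth_density M t x) * g x \<partial>lborel) =
    (\<integral>\<^sup>+y. (\<integral>\<^sup>+x. ennreal (normal_density 0 t (x - y)) * g x \<partial>lborel) \<partial>M)"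
proof -
  interpret P: pair_sigma_finite lborel M
    by (simp add: pair_sigma_finite_def lborel.sigma_finite_measure_axioms sigma_finite_measure_axioms)
  have "ennreal (gauss_smooth_density M t x) = (\<integral>\<^sup>+y. ennreal (normal_density 0 t (x - y)) \<partial>M)" for x
    unfolding gauss_smooth_density_def
    using integrable_normal_density_diff[OF assms(1)]
    by (subst nn_integral_eq_integral) (auto simp: normal_density_nonneg)
  then have "(\<integral>\<^sup>+x. ennreal (gauss_smooth_density M t x) * g x \<partial>lborel)
      = (\<integral>\<^sup>+x. (\<integral>\<^sup>+y. ennreal (normal_density 0 t (x - y)) * g x \<partial>M) \<partial>lborel)"
    by (simp add: nn_integral_multc)
  also have "\<dots> = (\<integral>\<^sup>+y. (\<integral>\<^sup>+x. ennreal (normal_density 0 t (x - y)) * g x \<partial>lborel) \<partial>M)"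
    by (rule P.Fubini'[symmetric]) measurable
  finally show ?thesis .
qed

lemma nn_integral_gauss_smooth_density_1:
  assumes "t > 0"
  shows "(\<integral>\<^sup>+x. ennreal (gauss_smooth_density M t x) \<partial>lborel) = 1"
  using nn_integral_gauss_smooth_density[OF assms, of "\<lambda>_. 1"] emeasure_space_1
  by (simp add: nn_integral_normal_density_shift[OF assms])

lemma nn_integral_laplace_avg_le:
  assumes "s > 0"
  shows "(\<integral>\<^sup>+x. ennreal (laplace_avg M s x) \<partial>lborel) \<le> ennreal (2 * s)"
proof -
  interpret P: pair_sigma_finite lborel M
    by (simp add: pair_sigma_finite_def lborel.sigma_finite_measure_axioms sigma_finite_measure_axioms)
  have "ennreal (laplace_avg M s x) = (\<integral>\<^sup>+y. ennreal (exp (- \<bar>x - y\<bar> / s)) \<partial>M)" for x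
    unfolding laplace_avg_def
    using integrable_laplace[OF assms]
    by (subst nn_integral_eq_integral) auto
  then have "(\<integral>\<^sup>+x. ennreal (laplace_avg M s x) \<partial>lborel)
      = (\<integral>\<^sup>+x. (\<integral>\<^sup>+y. ennreal (exp (- \<bar>x - y\<bar> / s)) \<partial>M) \<partial>lborel)"
    by simp
  also have "\<dots> = (\<integral>\<^sup>+y. (\<integral>\<^sup>+x. ennreal (exp (- \<bar>x - y\<bar> / s)) \<partial>lborel) \<partial>M)"
    by (rule P.Fubini'[symmetric]) measurable
  also have "\<dots> \<le> (\<integral>\<^sup>+y. ennreal (2 * s) \<partial>M)"
    by (intro nn_integral_mono nn_integral_laplace_le assms)
  also have "\<dots> = ennreal (2 * s)" using emeasure_space_1 by simp
  finally show ?thesis .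
qed

section \<open>Two-sided comparison of the Gaussian and Laplace costs\<close>

lemma laplace_cost_le_gauss_cost:
  assumes "t > 0"
  shows "laplace_cost M t \<le> gauss_cost M t + 1"
proof -
  let ?D = "\<lambda>x. ennreal (- ln (laplace_avg M t x))"
  let ?n = "\<lambda>x y. ennreal (normal_density 0 t (x - y))"
  have D_le: "?D y \<le> ?D x + ennreal (\<bar>x - y\<bar> / t)" for x y
    using neg_ln_laplace_avg_le[OF assms, of y x] laplace_avg_le_1[OF assms, of x]
      laplace_avg_pos[OF assms, of x] assms
    by (subst ennreal_plus[symmetric]) (auto simp: abs_minus_commute intro!: ennreal_leI)
  \<comment> \<open>A Gaussian weight of mass 1 around each \<open>y\<close> is inserted, so that
    \<open>D_le\<close> can move the argument from \<open>y\<close> to \<open>x\<close>; the mean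
    displacement costs at most t / t = 1.\<close>
  have "laplace_cost M t = (\<integral>\<^sup>+y. (\<integral>\<^sup>+x. ?n x y * ?D y \<partial>lborel) \<partial>M)"
    unfolding laplace_cost_def
    by (simp add: nn_integral_multc nn_integral_normal_density_shift[OF assms])
  also have "\<dots> \<le> (\<integral>\<^sup>+y. (\<integral>\<^sup>+x. ?n x y * ?D x + ?n x y * ennreal (\<bar>x - y\<bar> / t) \<partial>lborel) \<partial>M)"
    by (intro nn_integral_mono) (auto simp: D_le mult_left_mono simp flip: distrib_left)
  also have "\<dots> = (\<integral>\<^sup>+y. (\<integral>\<^sup>+x. ?n x y * ?D x \<partial>lborel)
      + (\<integral>\<^sup>+x. ?n x y * ennreal (\<bar>x - y\<bar> / t) \<partial>lborel) \<partial>M)"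
    by (intro nn_integral_cong nn_integral_add) auto
  also have "\<dots> \<le> (\<integral>\<^sup>+y. (\<integral>\<^sup>+x. ?n x y * ?D x \<partial>lborel) + 1 \<partial>M)"
    using nn_integral_normal_density_abs_shift[OF assms assms] assms
    by (intro nn_integral_mono add_mono) auto
  also have "\<dots> = (\<integral>\<^sup>+y. (\<integral>\<^sup>+x. ?n x y * ?D x \<partial>lborel) \<partial>M) + 1"
    using emeasure_space_1 by (subst nn_integral_add) auto
  also have "(\<integral>\<^sup>+y. (\<integral>\<^sup>+x. ?n x y * ?D x \<partial>lborel) \<partial>M)
      = (\<integral>\<^sup>+x. ennreal (gauss_smooth_density M t x) * ?D x \<partial>lborel)"
    by (rule nn_integral_gauss_smooth_density[symmetric]) (use assms in auto)
  also have "\<dots> \<le> gauss_cost M t"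
    unfolding gauss_cost_def
    using gauss_smooth_density_le_laplace_avg[OF assms] gauss_smooth_density_pos[OF assms]
      laplace_avg_pos[OF assms] assms
    by (intro nn_integral_mono mult_left_mono ennreal_leI) auto
  finally show ?thesis by (simp add: add_right_mono)
qed

text \<open>Gibbs' inequality replaces \<open>- ln (t * p)\<close> by the negated logarithm of the
  Laplace average plus ln(2 s / t). The Lipschitz bound then moves the argument back to the Gaussian
  centre at mean cost at most t / s.\<close>

lemma gauss_cost_le_laplace_cost:
  assumes "t > 0" "s > 0"
  shows "gauss_cost M t \<le> laplace_cost M s + ennreal (t / s + max 0 (ln (2 * s / t)))"
proof -
  let ?p = "gauss_smooth_density M t"
  let ?D = "laplace_avg M s"
  let ?lD = "\<lambda>x. ennreal (- ln (?D x))"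
  \<comment> \<open>The positive part is taken because ln(2 s / t) can be negative, which
    \<open>ennreal\<close> would not represent.\<close>
  define K where "K = max 0 (ln (2 * s / t))"
  have K0: "K \<ge> 0" by (simp add: K_def)
  \<comment> \<open>Pointwise Gibbs: ln z is at most z - 1 for z = D / (2 s p), multiplied by p. The
    term p stays on the left so that every summand is nonnegative; its mass 1 later offsets the mass
    of D / (2 s), which is at most 1.\<close>
  have pw: "ennreal (?p x) * ennreal (- ln (t * ?p x)) + ennreal (?p x)
      \<le> ennreal (?p x) * ?lD x + ennreal (?p x) * ennreal K + ennreal (?D x / (2 * s))" for x
  proof -
    have p: "?p x > 0" and D: "?D x > 0"
      using gauss_smooth_density_pos laplace_avg_pos assms by auto
    have tp: "t * ?p x \<le> 1"
      using gauss_smooth_density_le_laplace_avg[OF assms(1)] laplace_avg_le_1[OF assms(1)]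
      by (rule order_trans)
    have "ln (?D x / (2 * s) / ?p x) \<le> ?D x / (2 * s) / ?p x - 1"
      using p D assms by (intro ln_le_minus_one) auto
    then have "?p x * ln (?D x / (2 * s) / ?p x) \<le> ?p x * (?D x / (2 * s) / ?p x - 1)"
      using p by (intro mult_left_mono) auto
    also have "\<dots> = ?D x / (2 * s) - ?p x"
      using p by (simp add: field_simps)
    also have "ln (?D x / (2 * s) / ?p x) = ln (?D x) - ln (t * ?p x) - ln (2 * s / t)"
      using p D assms by (simp add: ln_div ln_mult)
    finally have "?p x * (- ln (t * ?p x)) + ?p x
        \<le> ?p x * (- ln (?D x)) + ?p x * ln (2 * s / t) + ?D x / (2 * s)"
      by (simp add: algebra_simps)
    also have "\<dots> \<le> ?p x * (- ln (?D x)) + ?p x * K + ?D x / (2 * s)"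
      using p by (intro add_mono mult_left_mono) (auto simp: K_def)
    finally have *: "?p x * (- ln (t * ?p x)) + ?p x \<le> \<dots>" .
    have n: "0 \<le> - ln (t * ?p x)" "0 \<le> - ln (?D x)"
      using tp p D assms laplace_avg_le_1[OF assms(2)] by auto
    have "ennreal (?p x) * ennreal (- ln (t * ?p x)) + ennreal (?p x)
        = ennreal (?p x * (- ln (t * ?p x)) + ?p x)"
      using n p by (intro ennreal_mult_plus[symmetric]) auto
    also have "\<dots> \<le> ennreal (?p x * (- ln (?D x)) + ?p x * K + ?D x / (2 * s))"
      by (rule ennreal_leI) (rule *)
    also have "\<dots> = ennreal (?p x) * ?lD x + ennreal (?p x) * ennreal K + ennreal (?D x / (2 * s))"
    proof -
      have "0 \<le> ?p x" "0 \<le> ?D x / (2 * s)" "0 \<le> ?p x * K + ?D x / (2 * s)"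
        using p D K0 assms by auto
      then show ?thesis
        using n K0 by (simp only: add.assoc ennreal_mult_plus)
    qed
    finally show ?thesis .
  qed
  have Dle1: "(\<integral>\<^sup>+x. ennreal (?D x / (2 * s)) \<partial>lborel) \<le> 1"
  proof -
    have "(\<integral>\<^sup>+x. ennreal (?D x / (2 * s)) \<partial>lborel) = (\<integral>\<^sup>+x. ennreal (?D x) * ennreal (1 / (2 * s)) \<partial>lborel)"
      using laplace_avg_pos[OF assms(2)] assms
      by (intro nn_integral_cong) (simp flip: ennreal_mult add: less_imp_le)
    also have "\<dots> \<le> ennreal (2 * s) * ennreal (1 / (2 * s))"
      using nn_integral_laplace_avg_le[OF assms(2)] by (simp add: nn_integral_multc mult_right_mono)
    also have "\<dots> = 1" using assms by (simp flip: ennreal_mult)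
    finally show ?thesis .
  qed
  have "gauss_cost M t + 1
      = (\<integral>\<^sup>+x. ennreal (?p x) * ennreal (- ln (t * ?p x)) + ennreal (?p x) \<partial>lborel)"
    unfolding gauss_cost_def
    by (subst nn_integral_add) (auto simp: nn_integral_gauss_smooth_density_1[OF assms(1)])
  also have "\<dots> \<le> (\<integral>\<^sup>+x. ennreal (?p x) * ?lD x + ennreal (?p x) * ennreal K + ennreal (?D x / (2 * s)) \<partial>lborel)"
    by (intro nn_integral_mono pw)
  also have "\<dots> = (\<integral>\<^sup>+x. ennreal (?p x) * ?lD x \<partial>lborel) + ennreal K
      + (\<integral>\<^sup>+x. ennreal (?D x / (2 * s)) \<partial>lborel)"
    by (simp add: nn_integral_add nn_integral_multc nn_integral_gauss_smooth_density_1[OF assms(1)])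
  also have "\<dots> \<le> (\<integral>\<^sup>+x. ennreal (?p x) * ?lD x \<partial>lborel) + ennreal K + 1"
    using Dle1 by (intro add_left_mono)
  \<comment> \<open>The summand 1 on both sides is finite, so it cancels even when the costs are
    infinite.\<close>
  finally have "gauss_cost M t \<le> (\<integral>\<^sup>+x. ennreal (?p x) * ?lD x \<partial>lborel) + ennreal K"
    by (simp add: add.commute[of _ 1])
  also have "(\<integral>\<^sup>+x. ennreal (?p x) * ?lD x \<partial>lborel)
      = (\<integral>\<^sup>+y. (\<integral>\<^sup>+x. ennreal (normal_density 0 t (x - y)) * ?lD x \<partial>lborel) \<partial>M)"
    by (rule nn_integral_gauss_smooth_density) (use assms in auto)
  also have "\<dots> \<le> (\<integral>\<^sup>+y. (\<integral>\<^sup>+x. ennreal (normal_density 0 t (x - y)) * (?lD y + ennreal (\<bar>x - y\<bar> / s)) \<partial>lborel) \<partial>M)"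
  proof (intro nn_integral_mono mult_left_mono)
    fix x y
    show "?lD x \<le> ?lD y + ennreal (\<bar>x - y\<bar> / s)"
      using neg_ln_laplace_avg_le[OF assms(2), of x y] laplace_avg_le_1[OF assms(2), of y]
        laplace_avg_pos[OF assms(2), of y] assms
      by (subst ennreal_plus[symmetric]) (auto intro!: ennreal_leI)
  qed auto
  also have "\<dots> \<le> (\<integral>\<^sup>+y. ?lD y + ennreal (t / s) \<partial>M)"
    by (intro nn_integral_mono nn_integral_normal_density_add assms)
  also have "\<dots> = laplace_cost M s + ennreal (t / s)"
    unfolding laplace_cost_def using emeasure_space_1 by (subst nn_integral_add) auto
  finally show ?thesis
    using K0 assms by (simp add: K_def[symmetric] ennreal_plus add.assoc add_right_mono)
qed

section \<open>Entropy expressed through the Gaussian cost\<close>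

lemma entropyH_gauss_smooth_density:
  assumes "0 < t" "t < 1"
  shows "entropyH (gauss_smooth_density M t) = ereal (- ln t) - enn2ereal (gauss_cost M t)"
proof -
  let ?p = "gauss_smooth_density M t"
  define P where "P = (\<integral>\<^sup>+x. ennreal (max 0 (?p x * ln (?p x))) \<partial>lborel)"
  define N where "N = (\<integral>\<^sup>+x. ennreal (max 0 (- (?p x * ln (?p x)))) \<partial>lborel)"
  have lt: "ln t < 0" using assms by simp
  have p: "?p x > 0" for x using gauss_smooth_density_pos assms by auto
  have tp: "0 \<le> - ln (t * ?p x)" for x
  proof -
    have "t * ?p x \<le> 1"
      using gauss_smooth_density_le_laplace_avg[OF assms(1)] laplace_avg_le_1[OF assms(1)]
      by (rule order_trans)
    then show ?thesis using p[of x] assms by simp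
  qed
  \<comment> \<open>Since p has mass 1, integrating this identity gives the formula;
    \<open>t < 1\<close> makes \<open>- ln t\<close> positive, so it embeds in
    \<open>ennreal\<close>.\<close>
  have split: "?p x * ln (?p x) + ?p x * (- ln (t * ?p x)) = ?p x * (- ln t)" for x
    using p[of x] assms by (simp add: ln_mult algebra_simps)
  have pc: "(\<integral>\<^sup>+x. ennreal (?p x * (- ln t)) \<partial>lborel) = ennreal (- ln t)"
  proof -
    have "(\<integral>\<^sup>+x. ennreal (?p x * (- ln t)) \<partial>lborel) = (\<integral>\<^sup>+x. ennreal (?p x) * ennreal (- ln t) \<partial>lborel)"
      using p lt by (intro nn_integral_cong ennreal_mult) (auto intro: less_imp_le)
    then show ?thesis
      by (simp add: nn_integral_multc nn_integral_gauss_smooth_density_1[OF assms(1)])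
  qed
  \<comment> \<open>The identity is integrated in a form without subtraction, the negative part of p
    ln p being moved to the other side.\<close>
  have "P + gauss_cost M t
      = (\<integral>\<^sup>+x. ennreal (max 0 (?p x * ln (?p x))) + ennreal (?p x) * ennreal (- ln (t * ?p x)) \<partial>lborel)"
    unfolding P_def gauss_cost_def by (rule nn_integral_add[symmetric]) measurable
  also have "\<dots> = (\<integral>\<^sup>+x. ennreal (max 0 (- (?p x * ln (?p x)))) + ennreal (?p x * (- ln t)) \<partial>lborel)"
  proof (rule nn_integral_cong)
    fix x
    have "ennreal (max 0 (?p x * ln (?p x))) + ennreal (?p x) * ennreal (- ln (t * ?p x))
        = ennreal (max 0 (?p x * ln (?p x)) + ?p x * (- ln (t * ?p x)))"
      using ennreal_mult_plus[of "?p x" "- ln (t * ?p x)" "max 0 (?p x * ln (?p x))"] p[of x] tp[of x]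
      by (metis add.commute less_imp_le max.cobounded1)
    also have "max 0 (?p x * ln (?p x)) + ?p x * (- ln (t * ?p x))
        = max 0 (- (?p x * ln (?p x))) + ?p x * (- ln t)"
      using split[of x] by (simp add: max_def)
    also have "ennreal \<dots> = ennreal (max 0 (- (?p x * ln (?p x)))) + ennreal (?p x * (- ln t))"
      using p[of x] lt by (intro ennreal_plus) (auto intro!: mult_nonneg_nonpos)
    finally show "ennreal (max 0 (?p x * ln (?p x))) + ennreal (?p x) * ennreal (- ln (t * ?p x)) = \<dots>" .
  qed
  also have "\<dots> = N + ennreal (- ln t)"
    unfolding N_def pc[symmetric] by (rule nn_integral_add) measurable
  finally have eq: "P + gauss_cost M t = N + ennreal (- ln t)" .
  \<comment> \<open>Finiteness of \<open>P\<close> excludes infinity minus infinity, so the sum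
    equation can be solved for \<open>P - N\<close> even when \<open>N\<close> and the cost are both
    infinite.\<close>
  have "P \<le> ennreal (- ln t)"
    unfolding P_def pc[symmetric]
  proof (intro nn_integral_mono ennreal_leI max.boundedI)
    fix x
    have "0 \<le> ?p x * (- ln (t * ?p x))" "0 \<le> ?p x * (- ln t)"
      using p[of x] tp[of x] lt by (auto intro!: mult_nonneg_nonpos)
    then show "0 \<le> ?p x * (- ln t)" "?p x * ln (?p x) \<le> ?p x * (- ln t)"
      using split[of x] by linarith+
  qed
  then have Pf: "P \<noteq> \<top>" by (auto simp: top_unique)
  have "enn2ereal P + enn2ereal (gauss_cost M t) = enn2ereal N + ereal (- ln t)"
    using arg_cong[OF eq, of enn2ereal] lt by (simp add: plus_ennreal.rep_eq enn2ereal_ennreal)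
  moreover have "enn2ereal P \<noteq> \<infinity>" "0 \<le> enn2ereal P" "0 \<le> enn2ereal N" "0 \<le> enn2ereal (gauss_cost M t)"
    using Pf by auto
  ultimately have "enn2ereal P - enn2ereal N = ereal (- ln t) - enn2ereal (gauss_cost M t)"
    by (cases "enn2ereal P"; cases "enn2ereal N"; cases "enn2ereal (gauss_cost M t)") auto
  then show ?thesis
    unfolding entropyH_def P_def N_def .
qed

end

section \<open>Bounded errors vanish in the normalised lower limit\<close>

lemma Liminf_le_of_bounded_excess:
  fixes u v :: "real \<Rightarrow> ereal" and K :: real
  assumes "eventually (\<lambda>t. u t \<le> v t + ereal K) (at_right 0)"
  shows "Liminf (at_right 0) (\<lambda>t. u t / ereal \<bar>ln t\<bar>) \<le> Liminf (at_right 0) (\<lambda>t. v t / ereal \<bar>ln t\<bar>)"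
proof (rule ereal_le_epsilon2)
  fix e :: real assume e: "0 < e"
  have "filterlim (\<lambda>t::real. \<bar>ln t\<bar>) at_top (at_right 0)"
    using filterlim_mono[OF ln_at_0 at_bot_le_at_infinity order_refl]
    by (auto dest: filterlim_at_infinity_imp_norm_at_top)
  \<comment> \<open>The bound 1 keeps the divisor positive, and K / e makes the excess at most e |ln
    t|, hence at most e after division.\<close>
  then have "eventually (\<lambda>t::real. max 1 (K / e) < \<bar>ln t\<bar>) (at_right 0)"
    unfolding filterlim_at_top_dense by blast
  with assms have "eventually (\<lambda>t. u t / ereal \<bar>ln t\<bar> \<le> v t / ereal \<bar>ln t\<bar> + ereal e) (at_right 0)"
  proof eventually_elim
    case (elim t)
    then have l: "0 < \<bar>ln t\<bar>" and "K \<le> e * \<bar>ln t\<bar>" using e by (auto simp: field_simps)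
    then have "u t \<le> v t + ereal (e * \<bar>ln t\<bar>)"
      using elim(1) by (meson add_left_mono ereal_less_eq(3) order_trans)
    then have "u t / ereal \<bar>ln t\<bar> \<le> (v t + ereal (e * \<bar>ln t\<bar>)) / ereal \<bar>ln t\<bar>"
      using l by (intro ereal_divide_right_mono) auto
    also have "\<dots> = v t / ereal \<bar>ln t\<bar> + ereal e"
      using l by (cases "v t") (auto simp: field_simps)
    finally show ?case .
  qed
  then have "Liminf (at_right 0) (\<lambda>t. u t / ereal \<bar>ln t\<bar>)
      \<le> Liminf (at_right 0) (\<lambda>t. v t / ereal \<bar>ln t\<bar> + ereal e)"
    by (rule Liminf_mono)
  also have "\<dots> = Liminf (at_right 0) (\<lambda>t. v t / ereal \<bar>ln t\<bar>) + ereal e"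
    by (rule Liminf_add_ereal_right) auto
  finally show "Liminf (at_right 0) (\<lambda>t. u t / ereal \<bar>ln t\<bar>)
      \<le> Liminf (at_right 0) (\<lambda>t. v t / ereal \<bar>ln t\<bar>) + ereal e" .
qed

text \<open>The order reverses twice: the cost enters the entropy with a minus sign, and the lower
  limit enters \<open>delta_c\<close> with a minus sign. If the cost of \<sigma> is infinite, so is
  that of \<rho>, and both entropies are minus infinity.\<close>

lemma delta_c_mono:
  assumes "real_distribution \<rho>" "real_distribution \<sigma>"
    and "\<And>t. 0 < t \<Longrightarrow> gauss_cost \<sigma> t \<le> gauss_cost \<rho> t + ennreal K" and "0 \<le> K"
  shows "delta_c \<sigma> \<le> delta_c \<rho>"
proof -
  interpret r: real_distribution \<rho> by fact
  interpret s: real_distribution \<sigma> by fact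
  have "eventually (\<lambda>t::real. t \<in> {0<..<1}) (at_right 0)"
    by (rule eventually_at_right_real) simp
  then have "eventually (\<lambda>t. entropyH (gauss_smooth_density \<rho> t)
      \<le> entropyH (gauss_smooth_density \<sigma> t) + ereal K) (at_right 0)"
  proof eventually_elim
    case (elim t)
    have "enn2ereal (gauss_cost \<sigma> t) \<le> enn2ereal (gauss_cost \<rho> t + ennreal K)"
      using assms(3)[of t] elim by (simp add: less_eq_ennreal.rep_eq)
    also have "\<dots> = enn2ereal (gauss_cost \<rho> t) + ereal K"
      using assms(4) by (simp add: plus_ennreal.rep_eq enn2ereal_ennreal)
    finally show ?case
      using elim enn2ereal_nonneg[of "gauss_cost \<sigma> t"] enn2ereal_nonneg[of "gauss_cost \<rho> t"]
      by (cases "enn2ereal (gauss_cost \<sigma> t)"; cases "enn2ereal (gauss_cost \<rho> t)")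
         (auto simp: r.entropyH_gauss_smooth_density s.entropyH_gauss_smooth_density)
  qed
  then show ?thesis
    unfolding delta_c_def by (intro ereal_minus_mono Liminf_le_of_bounded_excess) auto
qed

section \<open>Push-forward and the bi-Lipschitz comparison\<close>

lemma laplace_avg_distr:
  assumes "f \<in> borel_measurable \<mu>"
  shows "laplace_avg (distr \<mu> borel f) s z = (\<integral>y. exp (- \<bar>z - f y\<bar> / s) \<partial>\<mu>)"
  unfolding laplace_avg_def using assms by (subst integral_distr) auto

lemma laplace_cost_distr:
  assumes "real_distribution \<mu>" and [measurable]: "f \<in> borel_measurable borel"
  shows "laplace_cost (distr \<mu> borel f) s =
    (\<integral>\<^sup>+x. ennreal (- ln (laplace_avg (distr \<mu> borel f) s (f x))) \<partial>\<mu>)"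
proof -
  interpret real_distribution \<mu> by fact
  interpret d: real_distribution "distr \<mu> borel f"
    by (rule real_distribution_distr) simp
  show ?thesis
    unfolding laplace_cost_def by (subst nn_integral_distr) auto
qed

theorem theorem5p1:
  fixes \<mu> :: "real measure" and f :: "real \<Rightarrow> real" and m M :: real
  assumes "prob_space \<mu>" and "sets \<mu> = sets borel"
    and "m > 0" and "M > 0"
    and "\<And>x y. m * \<bar>x - y\<bar> \<le> \<bar>f x - f y\<bar>"
    and "\<And>x y. \<bar>f x - f y\<bar> \<le> M * \<bar>x - y\<bar>"
  shows "delta_c \<mu> = delta_c (distr \<mu> borel f)"
proof -
  interpret real_distribution \<mu>
    using assms(1,2) by (simp add: real_distribution_def real_distribution_axioms_def)
  have "M-lipschitz_on UNIV f"
    using assms(4,6) by (intro lipschitz_onI) (auto simp: dist_real_def)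
  then have f [measurable]: "f \<in> borel_measurable borel"
    by (intro borel_measurable_continuous_onI lipschitz_on_continuous_on)
  define \<eta> where "\<eta> = distr \<mu> borel f"
  interpret e: real_distribution \<eta>
    unfolding \<eta>_def by (rule real_distribution_distr) simp
  have avg: "laplace_avg \<eta> s z = (\<integral>y. exp (- \<bar>z - f y\<bar> / s) \<partial>\<mu>)" for s z
    unfolding \<eta>_def by (rule laplace_avg_distr) simp
  have cost: "laplace_cost \<eta> s = (\<integral>\<^sup>+x. ennreal (- ln (laplace_avg \<eta> s (f x))) \<partial>\<mu>)" for s
    unfolding \<eta>_def by (rule laplace_cost_distr[OF real_distribution_axioms f])
  have int: "integrable \<mu> (\<lambda>y. exp (- \<bar>z - f y\<bar> / s))" if "s > 0" for s z
    using that by (intro integrable_const_bound[where B = 1]) auto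
  \<comment> \<open>The lower bound on |f x - f y| makes the image kernel at scale \<open>t\<close>
    at most the original kernel at scale \<open>t / m\<close>; the negated logarithm reverses
    this.\<close>
  have low: "laplace_cost \<mu> (t / m) \<le> laplace_cost \<eta> t" if t: "t > 0" for t
  proof -
    have "laplace_avg \<eta> t (f x) \<le> laplace_avg \<mu> (t / m) x" for x
      unfolding avg unfolding laplace_avg_def
      using t assms(3,5) by (intro integral_mono int integrable_laplace) (auto simp: field_simps)
    then show ?thesis
      unfolding cost unfolding laplace_cost_def
      using e.laplace_avg_pos[OF t] laplace_avg_pos[of "t / m"] t assms(3)
      by (intro nn_integral_mono ennreal_leI) auto
  qed
  \<comment> \<open>The upper bound makes the image kernel at scale \<open>M * t\<close> at least
    the original kernel at scale \<open>t\<close>.\<close>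
  have up: "laplace_cost \<eta> (M * t) \<le> laplace_cost \<mu> t" if t: "t > 0" for t
  proof -
    have Mt: "M * t > 0" using t assms(4) by simp
    have "laplace_avg \<mu> t x \<le> laplace_avg \<eta> (M * t) (f x)" for x
      unfolding avg unfolding laplace_avg_def
      using t Mt assms(4,6) by (intro integral_mono int integrable_laplace) (auto simp: field_simps)
    then show ?thesis
      unfolding cost unfolding laplace_cost_def
      using e.laplace_avg_pos[OF Mt] laplace_avg_pos[OF t]
      by (intro nn_integral_mono ennreal_leI) auto
  qed
  \<comment> \<open>The scales s = t / m and s = M t turn t / s and 2 s / t into numbers independent
    of \<open>t\<close>: m and 2 / m for \<open>K\<close>, 1 / M and 2 M for \<open>L\<close>. The
    final 1 is the loss in \<open>laplace_cost_le_gauss_cost\<close>.\<close>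
  define K where "K = m + max 0 (ln (2 / m)) + 1"
  define L where "L = 1 / M + max 0 (ln (2 * M)) + 1"
  have "gauss_cost \<mu> t \<le> gauss_cost \<eta> t + ennreal K" if t: "t > 0" for t
  proof -
    have "gauss_cost \<mu> t \<le> laplace_cost \<mu> (t / m) + ennreal (m + max 0 (ln (2 / m)))"
      using gauss_cost_le_laplace_cost[of t "t / m"] t assms(3) by simp
    also have "\<dots> \<le> gauss_cost \<eta> t + 1 + ennreal (m + max 0 (ln (2 / m)))"
      using low[OF t] e.laplace_cost_le_gauss_cost[OF t] by (intro add_right_mono) (rule order_trans)
    also have "\<dots> = gauss_cost \<eta> t + ennreal K"
      unfolding K_def using assms(3) by (subst (2) ennreal_plus) (auto simp: ac_simps)
    finally show ?thesis .
  qed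
  then have "delta_c \<mu> \<le> delta_c \<eta>"
    by (rule delta_c_mono[OF e.real_distribution_axioms real_distribution_axioms])
       (use assms(3) in \<open>auto simp: K_def\<close>)
  moreover have "gauss_cost \<eta> t \<le> gauss_cost \<mu> t + ennreal L" if t: "t > 0" for t
  proof -
    have "gauss_cost \<eta> t \<le> laplace_cost \<eta> (M * t) + ennreal (1 / M + max 0 (ln (2 * M)))"
      using e.gauss_cost_le_laplace_cost[of t "M * t"] t assms(4) by simp
    also have "\<dots> \<le> gauss_cost \<mu> t + 1 + ennreal (1 / M + max 0 (ln (2 * M)))"
      using up[OF t] laplace_cost_le_gauss_cost[OF t] by (intro add_right_mono) (rule order_trans)
    also have "\<dots> = gauss_cost \<mu> t + ennreal L"
      unfolding L_def using assms(4) by (subst (2) ennreal_plus) (auto simp: ac_simps)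
    finally show ?thesis .
  qed
  then have "delta_c \<eta> \<le> delta_c \<mu>"
    by (rule delta_c_mono[OF real_distribution_axioms e.real_distribution_axioms])
       (use assms(4) in \<open>auto simp: L_def\<close>)
  ultimately show ?thesis unfolding \<eta>_def by (rule antisym)
qed

end
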